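(* Let $P(\lambda)=\lambda^3A_0+\lambda^2A_2+\lambda A_1+A_0$ be a cubic matrix polynomial with $A_0,A_1,A_2\in\mathbb{C}^{n,n}$, and let $D$ be a nonempty open or closed subset of $\mathbb{C}$. If at least one of the following conditions holds: (a) the multivariate matrix polynomial $(z_1,z_2)\mapsto(z_1^3z_2^3+z_1^3+z_2^3)A_0+(z_1^2z_2^3+z_1^2)A_2+(z_1^3z_2+z_2)A_1+A_0$ is stable with respect to $D^2$ and $-1,\ \frac12-\frac{\sqrt3}{2}\mathrm{i},\ \frac12+\frac{\sqrt3}{2}\mathrm{i}\notin D$; (b) the multivariate matrix polynomial $(z_1,z_2)\mapsto z_2^3A_0+z_1z_2A_2+z_2A_1+A_0$ is stable with respect to $D^2$ and $0\notin D$; (c) the multivariate matrix polynomial $(z_1,z_2)\mapsto z_1z_2^3A_0+z_1z_2^2A_2+z_2^2A_1+z_1A_0$ is stable with respect to $D^2$ and $0\notin D$; then the matrix polynomial $P(\lambda)$ is hyperstable with respect to $D$.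
   Context: For a nonempty open or closed $D\subseteq\mathbb{C}$: a multivariate matrix polynomial $R(z_1,\dots,z_\kappa)$ with coefficients in $\mathbb{C}^{n,n}$ is stable with respect to $D^\kappa$ if $R(\mu_1,\dots,\mu_\kappa)x\neq0$ for all $(\mu_1,\dots,\mu_\kappa)\in D^\kappa$ and all $x\in\mathbb{C}^n\setminus\{0\}$. A one-variable matrix polynomial $P(\lambda)$ is hyperstable with respect to $D$ if for every $x\in\mathbb{C}^n\setminus\{0\}$ there exists $y\in\mathbb{C}^n\setminus\{0\}$ such that $y^*P(\mu)x\neq0$ for all $\mu\in D$. *)

theory Defs
  imports "HOL-Analysis.Analysis"
begin

text \<open>
  Matrix polynomials with coefficients in \<open>complex ^ 'n ^ 'n\<close> are represented by their evaluation
  maps, in one variable (\<open>complex \<Rightarrow> _\<close>) or in \<open>CARD('k)\<close> variables (\<open>complex ^ 'k \<Rightarrow> _\<close>). Over the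
  infinite field of complex numbers the evaluation map determines the polynomial. The two notions
  below depend on values only, so they are stated for arbitrary matrix-valued maps.
\<close>

text \<open>
  Needed because \<open>*s\<close> acts on vectors, \<open>*\<^sub>R\<close> takes real scalars only, and \<open>*\<close> on vectors
  is componentwise.
\<close>

definition scalar_matrix_mult :: "complex \<Rightarrow> complex ^ 'n ^ 'm \<Rightarrow> complex ^ 'n ^ 'm"
    (infixr \<open>*m\<close> 75)
  where "c *m A = (\<chi> i j. c * A $ i $ j)"

text \<open>\<open>y\<^sup>* v\<close>, conjugate-linear in the first argument.\<close>

definition conj_transpose_prod :: "complex ^ 'n \<Rightarrow> complex ^ 'n \<Rightarrow> complex"
  where "conj_transpose_prod y v = (\<Sum>i\<in>UNIV. cnj (y $ i) * v $ i)"

definition stable_wrt :: "complex set \<Rightarrow> (complex ^ 'k \<Rightarrow> complex ^ 'n ^ 'n) \<Rightarrow> bool"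
  where "stable_wrt D R \<longleftrightarrow>
    (\<forall>\<mu>. (\<forall>i. \<mu> $ i \<in> D) \<longrightarrow> (\<forall>x. x \<noteq> 0 \<longrightarrow> R \<mu> *v x \<noteq> 0))"

definition hyperstable_wrt :: "complex set \<Rightarrow> (complex \<Rightarrow> complex ^ 'n ^ 'n) \<Rightarrow> bool"
  where "hyperstable_wrt D P \<longleftrightarrow>
    (\<forall>x. x \<noteq> 0 \<longrightarrow> (\<exists>y. y \<noteq> 0 \<and> (\<forall>\<mu>\<in>D. conj_transpose_prod y (P \<mu> *v x) \<noteq> 0)))"

end

theory Submission
  imports Defs
begin

text \<open>
  Up to a nonzero scalar, each condition says that \<open>u + f z\<^sub>1 v + g z\<^sub>2 w\<close> never vanishes on
  \<open>D \<times> D\<close>, where \<open>u, v, w\<close> are the vectors \<open>A\<^sub>i x\<close> in a suitable order, and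
  \<open>P(\<mu>) x\<close> is a nonzero multiple of \<open>u + f \<mu> v + g \<mu> w\<close>. If \<open>u\<close> is not in the span of \<open>v, w\<close>, take
  \<open>y\<close> orthogonal to \<open>v, w\<close> but not to \<open>u\<close>. If \<open>u = a v + b w\<close>, then \<open>-a \<notin> f(D)\<close> or \<open>-b \<notin> g(D)\<close>; say the
  former. For \<open>y\<close> orthogonal to \<open>w\<close> but not to \<open>v\<close>, the value at \<open>\<mu>\<close> is \<open>(a + f \<mu>) y\<^sup>* v \<noteq> 0\<close>. If
  there is no such \<open>y\<close>, all vectors are on one line, and a vector spanning it serves as \<open>y\<close>.
\<close>

lemma conj_transpose_prod_add_right:
  "conj_transpose_prod y (v + w) = conj_transpose_prod y v + conj_transpose_prod y w"
  by (simp add: conj_transpose_prod_def algebra_simps sum.distrib)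

lemma conj_transpose_prod_scale_right:
  "conj_transpose_prod y (c *s v) = c * conj_transpose_prod y v"
  by (simp add: conj_transpose_prod_def sum_distrib_left algebra_simps)

lemma Re_conj_transpose_prod: "Re (conj_transpose_prod y v) = y \<bullet> v"
  by (simp add: conj_transpose_prod_def inner_vec_def inner_complex_def)

lemma conj_transpose_prod_self_eq_0_iff [simp]: "conj_transpose_prod y y = 0 \<longleftrightarrow> y = 0"
proof
  assume "conj_transpose_prod y y = 0"
  then have "y \<bullet> y = 0" by (simp flip: Re_conj_transpose_prod)
  then show "y = 0" by simp
qed (simp add: conj_transpose_prod_def)

lemma conj_transpose_prod_zero_left [simp]: "conj_transpose_prod 0 v = 0"
  by (simp add: conj_transpose_prod_def)

lemmas conj_transpose_prod_simps =
  conj_transpose_prod_add_right conj_transpose_prod_scale_right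

text \<open>
  Real orthogonality suffices: a complex subspace is closed under multiplication by \<open>\<i>\<close>, and
  the real inner product is the real part of \<open>y\<^sup>* s\<close>.
\<close>

lemma complex_subspace_separation:
  fixes S :: "(complex ^ 'n) set"
  assumes S: "vec.subspace S" and u: "u \<notin> S"
  obtains y where "\<And>s. s \<in> S \<Longrightarrow> conj_transpose_prod y s = 0" "conj_transpose_prod y u \<noteq> 0"
proof -
  have scaleR: "r *\<^sub>R s = complex_of_real r *s s" for r and s :: "complex ^ 'n"
    by (simp add: vec_eq_iff scaleR_conv_of_real[where 'a = complex])
  have "subspace S"
    unfolding subspace_def scaleR
    using vec.subspace_0[OF S] vec.subspace_add[OF S] vec.subspace_scale[OF S] by blast
  then have span: "span S = S" by (simp add: span_eq_iff)
  obtain p y where py: "p \<in> span S" "\<And>s. s \<in> span S \<Longrightarrow> orthogonal y s" "u = p + y"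
    using orthogonal_subspace_decomp_exists[of S u] by metis
  have Re0: "Re (conj_transpose_prod y s) = 0" if "s \<in> S" for s
    using py(2) that span by (simp add: Re_conj_transpose_prod orthogonal_def)
  have zero: "conj_transpose_prod y s = 0" if "s \<in> S" for s
    using Re0[OF that] Re0[OF vec.subspace_scale[OF S that], of \<i>]
    by (simp add: conj_transpose_prod_simps complex_eq_iff)
  have "y \<noteq> 0" using py u span by auto
  \<comment> \<open>Since \<open>p\<close> lies in \<open>S\<close>, pairing
    \<open>u = p + y\<close> with \<open>y\<close> leaves only \<open>y\<^sup>* y\<close>.\<close>
  then have "conj_transpose_prod y u \<noteq> 0"
    using py zero span by (simp add: conj_transpose_prod_simps)
  with zero show thesis by (rule that)
qed

text \<open>The witness is \<open>e\<close>: pairing it with \<open>t *s e\<close> gives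
  \<open>t\<close> times the squared norm of \<open>e\<close>, and neither factor vanishes when
  \<open>t *s e\<close> is nonzero.\<close>

lemma exists_conj_transpose_prod_nonzero_line:
  fixes e :: "complex ^ 'n"
  assumes "D \<noteq> {}" and "\<And>\<mu>. \<mu> \<in> D \<Longrightarrow> q \<mu> \<in> vec.span {e}" and "\<And>\<mu>. \<mu> \<in> D \<Longrightarrow> q \<mu> \<noteq> 0"
  shows "\<exists>y. \<forall>\<mu>\<in>D. conj_transpose_prod y (q \<mu>) \<noteq> 0"
proof (intro exI ballI)
  fix \<mu> assume "\<mu> \<in> D"
  then obtain t where "q \<mu> = t *s e" using assms(2) by (auto simp: vec.span_singleton)
  with assms(3)[OF \<open>\<mu> \<in> D\<close>] show "conj_transpose_prod e (q \<mu>) \<noteq> 0"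
    by (auto simp: conj_transpose_prod_simps)
qed

lemma exists_conj_transpose_prod_nonzero_pencil:
  fixes u v w :: "complex ^ 'n" and f g :: "'a \<Rightarrow> complex"
  assumes D: "D \<noteq> {}"
    and nz: "\<And>s t. s \<in> D \<Longrightarrow> t \<in> D \<Longrightarrow> u + f s *s v + g t *s w \<noteq> 0"
  shows "\<exists>y. \<forall>\<mu>\<in>D. conj_transpose_prod y (u + f \<mu> *s v + g \<mu> *s w) \<noteq> 0"
proof -
  have line: ?thesis if "u \<in> vec.span {e}" "v \<in> vec.span {e}" "w \<in> vec.span {e}" for e
    using that
    by (intro exists_conj_transpose_prod_nonzero_line[OF D, where e = e] nz vec.span_add vec.span_scale)
  consider "u \<notin> vec.span {v, w}"
    | a b where "u = a *s v + b *s w" "-a \<notin> f ` D"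
    | a b where "u = a *s v + b *s w" "-b \<notin> g ` D"
  proof (cases "u \<in> vec.span {v, w}")
    case True
    then obtain a b where u: "u = a *s v + b *s w"
      by (auto simp: vec.span_insert vec.span_singleton algebra_simps)
    \<comment> \<open>The points \<open>s\<close> and \<open>t\<close> in \<open>nz\<close> are
      independent, so \<open>-a\<close> and \<open>-b\<close> attained at different points of
      \<open>D\<close> would already produce a zero.\<close>
    have "\<not> (-a \<in> f ` D \<and> -b \<in> g ` D)"
    proof
      assume "-a \<in> f ` D \<and> -b \<in> g ` D"
      then obtain s t where st: "s \<in> D" "t \<in> D" "f s = -a" "g t = -b" by (metis imageE)
      then have "u + f s *s v + g t *s w = 0" by (simp add: u vec_eq_iff)
      with nz st show False by blast
    qed
    with u that(2,3) show thesis by blast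
  qed (use that in blast)
  then show ?thesis
  proof cases
    case 1
    then obtain y where "\<And>s. s \<in> vec.span {v, w} \<Longrightarrow> conj_transpose_prod y s = 0"
      "conj_transpose_prod y u \<noteq> 0"
      using complex_subspace_separation[OF vec.subspace_span] by metis
    then have "conj_transpose_prod y (u + f \<mu> *s v + g \<mu> *s w) \<noteq> 0" for \<mu>
      by (simp add: conj_transpose_prod_simps vec.span_base)
    then show ?thesis by blast
  next
    case (2 a b)
    show ?thesis
    \<comment> \<open>If \<open>v\<close> is a multiple of \<open>w\<close>, then so is
      \<open>u = a *s v + b *s w\<close>.\<close>
    proof (cases "v \<in> vec.span {w}")
      case True
      then show ?thesis
        using 2(1) by (intro line[of w]) (auto intro: vec.span_add vec.span_scale vec.span_base)
    next
      case False
      then obtain y where "\<And>s. s \<in> vec.span {w} \<Longrightarrow> conj_transpose_prod y s = 0"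
        and v: "conj_transpose_prod y v \<noteq> 0"
        using complex_subspace_separation[OF vec.subspace_span] by metis
      then have "conj_transpose_prod y (u + f \<mu> *s v + g \<mu> *s w)
          = (a + f \<mu>) * conj_transpose_prod y v" for \<mu>
        by (simp add: 2(1) conj_transpose_prod_simps vec.span_base algebra_simps)
      moreover have "a + f \<mu> \<noteq> 0" if "\<mu> \<in> D" for \<mu>
        using 2(2) that by (metis add_eq_0_iff imageI)
      ultimately show ?thesis using v by (intro exI[of _ y]) simp
    qed
  next
    case (3 a b)
    show ?thesis
    proof (cases "w \<in> vec.span {v}")
      case True
      then show ?thesis
        using 3(1) by (intro line[of v]) (auto intro: vec.span_add vec.span_scale vec.span_base)
    next
      case False
      then obtain y where "\<And>s. s \<in> vec.span {v} \<Longrightarrow> conj_transpose_prod y s = 0"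
        and w: "conj_transpose_prod y w \<noteq> 0"
        using complex_subspace_separation[OF vec.subspace_span] by metis
      then have "conj_transpose_prod y (u + f \<mu> *s v + g \<mu> *s w)
          = (b + g \<mu>) * conj_transpose_prod y w" for \<mu>
        by (simp add: 3(1) conj_transpose_prod_simps vec.span_base algebra_simps)
      moreover have "b + g \<mu> \<noteq> 0" if "\<mu> \<in> D" for \<mu>
        using 3(2) that by (metis add_eq_0_iff imageI)
      ultimately show ?thesis using w by (intro exI[of _ y]) simp
    qed
  qed
qed

lemma stable_wrt_2D:
  fixes R :: "complex ^ 2 \<Rightarrow> complex ^ 'n ^ 'n"
  assumes "stable_wrt D R" "x \<noteq> 0" "s \<in> D" "t \<in> D"
  shows "R (vector [s, t]) *v x \<noteq> 0"
  using assms by (auto simp: stable_wrt_def forall_2)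

text \<open>Common form of the three conditions. Stability makes \<open>c s t\<close> times the
  bracket nonzero, hence the bracket itself; passing back to \<open>q\<close> multiplies by
  \<open>d \<mu>\<close>, so that factor must not vanish.\<close>

lemma exists_conj_transpose_prod_nonzero:
  fixes u v w x :: "complex ^ 'n" and f g :: "complex \<Rightarrow> complex"
    and R :: "complex ^ 2 \<Rightarrow> complex ^ 'n ^ 'n"
  assumes D: "D \<noteq> {}" and R: "stable_wrt D R" and x: "x \<noteq> 0"
    and c: "\<And>s t. s \<in> D \<Longrightarrow> t \<in> D \<Longrightarrow> R (vector [s, t]) *v x = c s t *s (u + f s *s v + g t *s w)"
    and d: "\<And>\<mu>. \<mu> \<in> D \<Longrightarrow> q \<mu> = d \<mu> *s (u + f \<mu> *s v + g \<mu> *s w)"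
    and d0: "\<And>\<mu>. \<mu> \<in> D \<Longrightarrow> d \<mu> \<noteq> 0"
  shows "\<exists>y. y \<noteq> 0 \<and> (\<forall>\<mu>\<in>D. conj_transpose_prod y (q \<mu>) \<noteq> 0)"
proof -
  have "u + f s *s v + g t *s w \<noteq> 0" if "s \<in> D" "t \<in> D" for s t
    using c[OF that] stable_wrt_2D[OF R x that] by (metis vec.scale_zero_right)
  then obtain y where y: "\<forall>\<mu>\<in>D. conj_transpose_prod y (u + f \<mu> *s v + g \<mu> *s w) \<noteq> 0"
    by (metis exists_conj_transpose_prod_nonzero_pencil[OF D])
  with D have "y \<noteq> 0" by auto
  moreover have "conj_transpose_prod y (q \<mu>) \<noteq> 0" if "\<mu> \<in> D" for \<mu>
    using y that d0[OF that] unfolding d[OF that] conj_transpose_prod_scale_right by simp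
  ultimately show ?thesis by blast
qed

lemma scalar_matrix_mult_vec: "(c *m A) *v x = c *s (A *v x)"
  by (simp add: vec_eq_iff scalar_matrix_mult_def matrix_vector_mult_def sum_distrib_left
      algebra_simps)

text \<open>Identifies the points excluded in the first condition, so that division by
  \<open>z^3 + 1\<close> is possible on \<open>D\<close>.\<close>

lemma complex_cube_eq_minus_1:
  assumes "z ^ 3 + 1 = (0 :: complex)"
  shows "z \<in> {-1, 1/2 - complex_of_real (sqrt 3 / 2) * \<i>, 1/2 + complex_of_real (sqrt 3 / 2) * \<i>}"
proof -
  define r where "r = complex_of_real (sqrt 3 / 2) * \<i>"
  have "r ^ 2 = -3/4"
    by (simp add: r_def power_mult_distrib power_divide flip: of_real_power)
  \<comment> \<open>The last two factors multiply to
    \<open>(z - 1/2)^2 - r^2 = z^2 - z + 1\<close>.\<close>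
  then have "(z + 1) * (z - (1/2 - r)) * (z - (1/2 + r)) = z ^ 3 + 1"
    by algebra
  with assms show ?thesis by (auto simp: r_def eq_neg_iff_add_eq_0)
qed

theorem theorem5p3:
  fixes A0 A1 A2 :: "complex ^ 'n ^ 'n" and D :: "complex set"
  assumes "D \<noteq> {}" and "open D \<or> closed D"
    and
      "(stable_wrt D (\<lambda>z :: complex ^ 2.
            ((z$1)^3 * (z$2)^3 + (z$1)^3 + (z$2)^3) *m A0
          + ((z$1)^2 * (z$2)^3 + (z$1)^2) *m A2
          + ((z$1)^3 * z$2 + z$2) *m A1
          + A0)
        \<and> -1 \<notin> D
        \<and> 1/2 - complex_of_real (sqrt 3 / 2) * \<i> \<notin> D
        \<and> 1/2 + complex_of_real (sqrt 3 / 2) * \<i> \<notin> D)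
     \<or> (stable_wrt D (\<lambda>z :: complex ^ 2.
            (z$2)^3 *m A0 + (z$1 * z$2) *m A2 + z$2 *m A1 + A0)
        \<and> 0 \<notin> D)
     \<or> (stable_wrt D (\<lambda>z :: complex ^ 2.
            (z$1 * (z$2)^3) *m A0 + (z$1 * (z$2)^2) *m A2 + (z$2)^2 *m A1 + z$1 *m A0)
        \<and> 0 \<notin> D)"
  shows "hyperstable_wrt D (\<lambda>l. l^3 *m A0 + l^2 *m A2 + l *m A1 + A0)"
  unfolding hyperstable_wrt_def
proof (intro allI impI)
  fix x :: "complex ^ 'n" assume x: "x \<noteq> 0"
  let ?q = "\<lambda>l. (l^3 *m A0 + l^2 *m A2 + l *m A1 + A0) *v x"
  note expand = matrix_vector_mult_add_rdistrib scalar_matrix_mult_vec vec_eq_iff vector_2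
  from assms(3) show "\<exists>y. y \<noteq> 0 \<and> (\<forall>\<mu>\<in>D. conj_transpose_prod y (?q \<mu>) \<noteq> 0)"
  proof (elim disjE conjE, goal_cases)
    case 1
    then have nz: "z ^ 3 + 1 \<noteq> 0" if "z \<in> D" for z
      using complex_cube_eq_minus_1[of z] that by blast
    \<comment> \<open>With the lone \<open>A0\<close> included, the coefficient of \<open>A0\<close>
      is \<open>(s^3 + 1) * (t^3 + 1)\<close>; dividing by it leaves \<open>s\<close> only at
      \<open>A2\<close> and \<open>t\<close> only at \<open>A1\<close>.\<close>
    show ?case
      by (rule exists_conj_transpose_prod_nonzero[OF assms(1) 1(1) x,
          where u = "A0 *v x" and v = "A2 *v x" and w = "A1 *v x"
          and f = "\<lambda>z. z^2 / (z^3 + 1)" and g = "\<lambda>z. z / (z^3 + 1)"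
          and c = "\<lambda>s t. (s^3 + 1) * (t^3 + 1)" and d = "\<lambda>z. z^3 + 1"])
        (use nz in \<open>simp_all add: expand, simp_all add: field_simps\<close>)
  next
    case 2
    then have nz: "z \<noteq> 0" if "z \<in> D" for z using that by blast
    \<comment> \<open>Dividing by \<open>t\<close>, the coefficient of \<open>A1\<close>, leaves
      \<open>s\<close> at \<open>A2\<close> and merges both \<open>A0\<close> terms into
      \<open>g\<close>.\<close>
    show ?case
      by (rule exists_conj_transpose_prod_nonzero[OF assms(1) 2(1) x,
          where u = "A1 *v x" and v = "A2 *v x" and w = "A0 *v x"
          and f = "\<lambda>z. z" and g = "\<lambda>z. (z^3 + 1) / z"
          and c = "\<lambda>s t. t" and d = "\<lambda>z. z"])
        (use nz in \<open>simp_all add: expand, simp_all add: field_simps power2_eq_square\<close>)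
  next
    case 3
    then have nz: "z \<noteq> 0" if "z \<in> D" for z using that by blast
    \<comment> \<open>Dividing by \<open>s * t^2\<close>, the coefficient of \<open>A2\<close>,
      separates the variables.\<close>
    show ?case
      by (rule exists_conj_transpose_prod_nonzero[OF assms(1) 3(1) x,
          where u = "A2 *v x" and v = "A1 *v x" and w = "A0 *v x"
          and f = "\<lambda>z. 1 / z" and g = "\<lambda>z. (z^3 + 1) / z^2"
          and c = "\<lambda>s t. s * t^2" and d = "\<lambda>z. z^2"])
        (use nz in \<open>simp_all add: expand, simp_all add: field_simps power2_eq_square\<close>)
  qed
qed

end
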